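(* Let $s,t\ge 1$ be integers and let $d=\gcd(s,t)$. If $d=1$, then $C_{s(t)}(q)$ is a polynomial in $q$. If $d>1$, then $C_{s(t)}(q)$ is an infinite series (that is, it has infinitely many nonzero coefficients).
   Context: A partition of $n$ is a nonincreasing sequence of positive integers summing to $n$ (its size); the empty partition has size $0$. The hooklength of a box in the Young diagram of a partition is the number of boxes directly to its right plus the number of boxes directly below it plus $1$. For integers $s,t\ge 1$ (with $s>t$ or $s=t$ allowed), an $s \pmod t$-core is a partition having no hook whose length lies in $\{s,s+t,s+2t,s+3t,\dots\}$. Let $c_{s(t)}(n)$ be the number of $s \pmod t$-cores of size $n$, and $C_{s(t)}(q)=\sum_{n=0}^\infty c_{s(t)}(n)q^n$. *)

theory Defs
  imports "HOL-Computational_Algebra.Computational_Algebra"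
begin

definition partition_of :: "nat \<Rightarrow> nat list \<Rightarrow> bool" where
  "partition_of n p \<longleftrightarrow> sorted_wrt (\<ge>) p \<and> (\<forall>x\<in>set p. 0 < x) \<and> sum_list p = n"

text \<open>Boxes are pairs (row, column), both counted from 0, with rows going downwards.\<close>

definition young_diagram :: "nat list \<Rightarrow> (nat \<times> nat) set" where
  "young_diagram p = {(i, j). i < length p \<and> j < p ! i}"

definition hook_length :: "nat list \<Rightarrow> nat \<times> nat \<Rightarrow> nat" where
  "hook_length p = (\<lambda>(i, j).
     card {j'. j < j' \<and> (i, j') \<in> young_diagram p}
   + card {i'. i < i' \<and> (i', j) \<in> young_diagram p} + 1)"

definition mod_core :: "nat \<Rightarrow> nat \<Rightarrow> nat list \<Rightarrow> bool" where
  "mod_core s t p \<longleftrightarrow> (\<forall>b\<in>young_diagram p. hook_length p b \<notin> {s + k * t |k. True})"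

definition num_mod_cores :: "nat \<Rightarrow> nat \<Rightarrow> nat \<Rightarrow> nat" where
  "num_mod_cores s t n = card {p. partition_of n p \<and> mod_core s t p}"

definition mod_core_gf :: "nat \<Rightarrow> nat \<Rightarrow> int fps" where
  "mod_core_gf s t = Abs_fps (\<lambda>n. int (num_mod_cores s t n))"

text \<open>The set counted by \<^const>\<open>num_mod_cores\<close> is finite, so its cardinality is meaningful.\<close>

lemma finite_partitions_of: "finite {p. partition_of n p}"
proof (rule finite_subset)
  have "length p \<le> sum_list p" if "\<forall>x\<in>set p. 0 < x" for p :: "nat list"
    using that by (induction p) auto
  then show "{p. partition_of n p} \<subseteq> {p. set p \<subseteq> {..n} \<and> length p \<le> n}"
    by (auto simp: partition_of_def intro: member_le_sum_list)
qed (rule finite_lists_length_le, simp)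

lemma finite_mod_cores: "finite {p. partition_of n p \<and> mod_core s t p}"
  by (rule finite_subset[OF _ finite_partitions_of[of n]]) auto

end

theory Submission
  imports Defs "HOL-Number_Theory.Cong"
begin

text \<open>The hook lengths in row \<open>i\<close> of a partition are the numbers \<open>b - x\<close>, where \<open>b\<close> is the hook
  length at the head of that row and \<open>x < b\<close> is not itself the hook length at the head of a row.
  Hence the set \<open>B\<close> of the latter hook lengths, which does not contain \<open>0\<close>, characterises an
  \<open>s (mod t)\<close>-core by being closed under subtraction of each \<open>s + k t\<close>. If \<open>s\<close> and \<open>t\<close> are coprime,
  every \<open>b \<ge> s t\<close> has the form \<open>a s + k t\<close> with \<open>a \<ge> 1\<close>, and \<open>b \<in> B\<close> would give \<open>0 \<in> B\<close>; so \<open>B\<close> is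
  bounded. If \<open>d > 1\<close>, then \<open>B = {1, 1 + d, \<dots>, 1 + (m - 1) d}\<close> is closed under subtraction of
  multiples of \<open>d\<close>, for every \<open>m\<close>.\<close>

text \<open>For a partition and \<open>i < length p\<close>, this is the hook length of the box
  \<open>(i, 0)\<close>: arm \<open>p ! i - 1\<close>, leg \<open>length p - 1 - i\<close>, plus
  1.\<close>

definition beta :: "nat list \<Rightarrow> nat \<Rightarrow> nat" where
  "beta p i = p ! i + (length p - 1 - i)"

text \<open>Supplies the length of a column (\<open>P k\<close> being \<open>j < p ! k\<close>) and
  the number of rows whose \<open>beta\<close> exceeds a given \<open>x\<close>.\<close>

lemma obtain_initial_segment:
  fixes L :: nat
  assumes "\<And>i k. i \<le> k \<Longrightarrow> k < L \<Longrightarrow> P k \<Longrightarrow> P i"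
  obtains m where "m \<le> L" "\<And>k. k < L \<Longrightarrow> P k \<longleftrightarrow> k < m"
proof
  let ?Q = "\<lambda>m. m = L \<or> \<not> P m"
  let ?m = "LEAST m. ?Q m"
  have "?Q L" by simp
  then show le: "?m \<le> L" by (rule Least_le)
  have Q: "?Q ?m" using \<open>?Q L\<close> by (rule LeastI)
  show "P k \<longleftrightarrow> k < ?m" if "k < L" for k
  proof
    show "P k" if "k < ?m" using not_less_Least[OF that] by simp
    show "k < ?m" if "P k"
    proof (rule ccontr)
      assume "\<not> k < ?m"
      then have "?m \<le> k" by simp
      then show False using assms[of ?m k] \<open>k < L\<close> \<open>P k\<close> Q by auto
    qed
  qed
qed

text \<open>Here \<open>m\<close> is the length of column \<open>j\<close>, and \<open>length p + j - m\<close> is the number that is missing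
  from the hook lengths of the first column because of column \<open>j\<close>.\<close>

lemma hook_length_add:
  assumes m: "m \<le> length p" "\<And>k. k < length p \<Longrightarrow> j < p ! k \<longleftrightarrow> k < m"
    and i: "i < m"
  shows "hook_length p (i, j) + (length p + j - m) = beta p i"
proof -
  have "{j'. j < j' \<and> (i, j') \<in> young_diagram p} = {j<..<p ! i}"
    using m(1) i by (auto simp: young_diagram_def)
  moreover have "{i'. i < i' \<and> (i', j) \<in> young_diagram p} = {i<..<m}"
    using m by (auto simp: young_diagram_def)
  moreover have "j < p ! i" using m i by simp
  ultimately show ?thesis
    using m(1) i by (simp add: hook_length_def beta_def)
qed

lemma sorted_nth:
  fixes p :: "nat list"
  assumes "sorted_wrt (\<ge>) p" "i \<le> k" "k < length p"
  shows "p ! k \<le> p ! i"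
  using assms sorted_wrt_nth_less[of "(\<ge>)" p i k] by (cases "i = k") auto

lemma beta_antimono:
  assumes "sorted_wrt (\<ge>) p" "i \<le> k" "k < length p"
  shows "beta p k \<le> beta p i"
  unfolding beta_def using sorted_nth[OF assms] assms by linarith

lemma hook_length_not_beta_diff:
  assumes p: "sorted_wrt (\<ge>) p" and box: "(i, j) \<in> young_diagram p"
  obtains x where "hook_length p (i, j) + x = beta p i" "\<And>k. k < length p \<Longrightarrow> beta p k \<noteq> x"
proof -
  obtain m where m: "m \<le> length p" "\<And>k. k < length p \<Longrightarrow> j < p ! k \<longleftrightarrow> k < m"
    using obtain_initial_segment[of "length p" "\<lambda>k. j < p ! k"] sorted_nth[OF p]
    by (metis order_less_le_trans)
  have "i < m" using box m(2) by (auto simp: young_diagram_def)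
  \<comment> \<open>Rows \<open>k < m\<close> have a larger \<open>beta\<close>, the remaining rows
    a smaller one.\<close>
  moreover have "beta p k \<noteq> length p + j - m" if "k < length p" for k
    using m(2)[OF that] m(1) that by (cases "k < m") (auto simp: beta_def)
  ultimately show ?thesis using that[OF hook_length_add[OF m]] by blast
qed

lemma beta_diff_hook_length:
  assumes p: "sorted_wrt (\<ge>) p" and i: "i < length p"
    and x: "x < beta p i" "\<And>k. k < length p \<Longrightarrow> beta p k \<noteq> x"
  obtains j where "(i, j) \<in> young_diagram p" "hook_length p (i, j) + x = beta p i"
proof -
  obtain m where m: "m \<le> length p" "\<And>k. k < length p \<Longrightarrow> x < beta p k \<longleftrightarrow> k < m"
    using obtain_initial_segment[of "length p" "\<lambda>k. x < beta p k"] beta_antimono[OF p]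
    by (metis order_less_le_trans)
  \<comment> \<open>Solves \<open>length p + j - m = x\<close>, so that \<open>x\<close> becomes the
    number missing because of column \<open>j\<close>; \<open>ge\<close> below shows that the
    subtraction is not truncated.\<close>
  define j where "j = x - (length p - m)"
  have im: "i < m" using m(2)[OF i] x(1) by simp
  have below: "beta p k < x" if "m \<le> k" "k < length p" for k
    using m(2)[OF that(2)] x(2)[OF that(2)] that by linarith
  have ge: "length p - m \<le> x"
  proof (cases "m < length p")
    case True
    then show ?thesis using below[of m] by (simp add: beta_def)
  qed simp
  have "j < p ! k \<longleftrightarrow> k < m" if k: "k < length p" for k
  proof
    assume "k < m"
    \<comment> \<open>The last row with \<open>beta\<close> above \<open>x\<close> is the tight
      case: its leg is exactly \<open>length p - m\<close>.\<close>
    then have "p ! (m - 1) \<le> p ! k" using sorted_nth[OF p, of k "m - 1"] m(1) by simp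
    moreover have "x < beta p (m - 1)" using m \<open>k < m\<close> by simp
    ultimately show "j < p ! k" using ge m(1) \<open>k < m\<close> by (simp add: beta_def j_def)
  next
    assume j: "j < p ! k"
    show "k < m"
    proof (rule ccontr)
      assume "\<not> k < m"
      then have "p ! k \<le> p ! m" "beta p m < x"
        using sorted_nth[OF p, of m k] below[of m] k by auto
      then show False using j ge \<open>\<not> k < m\<close> k by (simp add: beta_def j_def)
    qed
  qed
  note col = this
  have "(i, j) \<in> young_diagram p" using col[OF i] im i by (simp add: young_diagram_def)
  moreover have "length p + j - m = x" using ge m(1) by (simp add: j_def)
  ultimately show ?thesis using that hook_length_add[OF m(1) col im] by simp
qed

text \<open>Otherwise \<open>s + k * t\<close>, as the difference of \<open>beta p i\<close> and a
  smaller missing number, would be a hook length in row \<open>i\<close>.\<close>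

lemma mod_core_beta_diff:
  assumes "mod_core s t p" "sorted_wrt (\<ge>) p" "i < length p" "beta p i = x + (s + k * t)" "s \<ge> 1"
  shows "x \<in> beta p ` {..<length p}"
proof (rule ccontr)
  assume "x \<notin> beta p ` {..<length p}"
  then obtain j where "(i, j) \<in> young_diagram p" "hook_length p (i, j) + x = beta p i"
    using beta_diff_hook_length[OF assms(2,3), of x] assms(4,5) by auto
  then show False using assms(1,4) by (force simp: mod_core_def)
qed

lemma beta_pos:
  assumes "partition_of n p" "i < length p"
  shows "0 < beta p i"
proof -
  have "0 < p ! i" using assms by (simp add: partition_of_def)
  then show ?thesis by (simp add: beta_def)
qed

text \<open>Descent: subtracting \<open>s\<close> repeatedly and finally \<open>s + k * t\<close>
  would put \<open>0\<close> among the first-column hook lengths, which are positive.\<close>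

lemma mod_core_beta_not_combination:
  assumes c: "mod_core s t p" and p: "partition_of n p" and "s \<ge> 1"
  shows "i < length p \<Longrightarrow> beta p i \<noteq> Suc a * s + k * t"
proof (induction a arbitrary: i k)
  case 0
  then show ?case
    using mod_core_beta_diff[OF c _ 0, of 0 k] p beta_pos[OF p] \<open>s \<ge> 1\<close>
    by (force simp: partition_of_def)
next
  case (Suc a)
  show ?case
  proof
    assume "beta p i = Suc (Suc a) * s + k * t"
    then have "Suc a * s + k * t \<in> beta p ` {..<length p}"
      using mod_core_beta_diff[OF c _ Suc.prems, of "Suc a * s + k * t" 0] p \<open>s \<ge> 1\<close>
      by (simp add: partition_of_def)
    then obtain i' where "i' < length p" "beta p i' = Suc a * s + k * t"
      by (metis imageE lessThan_iff)
    then show False using Suc.IH by blast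
  qed
qed

lemma coprime_combination:
  fixes s t b :: nat
  assumes "coprime s t" "t \<ge> 1" "s * t \<le> b"
  obtains a k where "b = Suc a * s + k * t"
proof -
  obtain y where y: "[s * y = Suc 0] (mod t)" using cong_solve_coprime_nat[OF assms(1)] by blast
  \<comment> \<open>\<open>a + 1\<close> is the representative of \<open>b y\<close> modulo \<open>t\<close> in \<open>{1..t}\<close>\<close>
  define a where "a = (b * y + (t - 1)) mod t"
  have "[Suc a = b * y] (mod t)"
  proof -
    have "[Suc a = Suc (b * y + (t - 1))] (mod t)"
      unfolding a_def cong_def by (rule mod_Suc_eq)
    also have "Suc (b * y + (t - 1)) = b * y + t" using assms(2) by simp
    finally show ?thesis by (simp add: cong_def)
  qed
  then have "[Suc a * s = b * y * s] (mod t)" by (rule cong_scalar_right)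
  also have "[b * y * s = b * 1] (mod t)"
    using cong_scalar_left[OF y, of b] by (simp add: ac_simps)
  finally have "[b = Suc a * s] (mod t)" by (simp add: cong_sym)
  \<comment> \<open>Here \<open>s * t \<le> b\<close> enters: it makes \<open>b - Suc a * s\<close>
    nonnegative, so that \<open>k\<close> is a natural number.\<close>
  moreover have "Suc a \<le> t" using assms(2) by (simp add: a_def Suc_le_eq)
  then have "Suc a * s \<le> b" using assms(3) by (metis mult.commute mult_le_mono1 order_trans)
  ultimately obtain k where "b = k * t + Suc a * s"
    by (metis cong_le_nat add.commute mult.commute)
  then show ?thesis using that by (simp add: add.commute)
qed

lemma finite_coprime_mod_cores:
  assumes "coprime s t" "s \<ge> 1" "t \<ge> 1"
  shows "finite {p. (\<exists>n. partition_of n p) \<and> mod_core s t p}"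
proof (rule finite_subset)
  show "{p. (\<exists>n. partition_of n p) \<and> mod_core s t p} \<subseteq> {p. set p \<subseteq> {..s * t} \<and> length p \<le> s * t}"
  proof clarify
    fix p n assume p: "partition_of n p" and c: "mod_core s t p"
    have less: "beta p i < s * t" if "i < length p" for i
      using coprime_combination[OF assms(1,3), of "beta p i"]
        mod_core_beta_not_combination[OF c p assms(2) that] by (metis not_le)
    have "p ! i \<le> s * t" if "i < length p" for i
      using less[OF that] by (simp add: beta_def)
    then have "set p \<subseteq> {..s * t}" by (auto simp: in_set_conv_nth)
    moreover have "length p \<le> s * t"
      \<comment> \<open>\<open>beta p 0\<close> is at least \<open>length p - 1\<close>; the strict
        bound makes up for the 1.\<close>
      using less[of 0] by (cases "p = []") (auto simp: beta_def)
    ultimately show "set p \<subseteq> {..s * t} \<and> length p \<le> s * t" ..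
  qed
qed (rule finite_lists_length_le, simp)

lemma num_mod_cores_neq_0_iff:
  "num_mod_cores s t n \<noteq> 0 \<longleftrightarrow> (\<exists>p. partition_of n p \<and> mod_core s t p)"
  using finite_mod_cores[of n s t] by (auto simp: num_mod_cores_def)

lemma fps_of_poly_if_finite:
  fixes f :: "'a::comm_ring_1 fps"
  assumes "finite {n. fps_nth f n \<noteq> 0}"
  shows "\<exists>P. f = fps_of_poly P"
proof
  from assms have "\<forall>\<^sub>\<infinity>n. fps_nth f n = 0" by (simp add: MOST_iff_cofinite)
  then show "f = fps_of_poly (Abs_poly (fps_nth f))"
    by (intro fps_ext) (simp add: Abs_poly_inverse)
qed

text \<open>Each part is the intended first-column hook length \<open>1 + (m - 1 - i) * d\<close>
  minus the leg \<open>m - 1 - i\<close>, for \<open>d \<ge> 1\<close>.\<close>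

definition runner_core :: "nat \<Rightarrow> nat \<Rightarrow> nat list" where
  "runner_core d m = map (\<lambda>i. 1 + (m - 1 - i) * (d - 1)) [0..<m]"

lemma runner_core_partition: "partition_of (sum_list (runner_core d m)) (runner_core d m)"
  by (auto simp: partition_of_def runner_core_def sorted_wrt_iff_nth_less intro!: mult_le_mono1)

lemma le_sum_list_runner_core: "m \<le> sum_list (runner_core d m)"
  using sum_list_mono[of "[0..<m]" "\<lambda>_. 1" "\<lambda>i. 1 + (m - 1 - i) * (d - 1)"]
  by (simp add: runner_core_def sum_list_triv)

lemma beta_runner_core:
  assumes "d \<ge> 1" "i < m"
  shows "beta (runner_core d m) i = 1 + (m - 1 - i) * d"
  using assms by (cases d) (simp_all add: beta_def runner_core_def)

lemma mod_core_runner_core: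
  assumes "d > 1" "d dvd s" "d dvd t"
  shows "mod_core s t (runner_core d m)"
  unfolding mod_core_def
proof clarify
  fix i j k
  let ?p = "runner_core d m"
  assume box: "(i, j) \<in> young_diagram ?p" and hook: "hook_length ?p (i, j) = s + k * t"
  have len: "length ?p = m" by (simp add: runner_core_def)
  have i: "i < m" using box by (simp add: young_diagram_def len)
  have "sorted_wrt (\<ge>) ?p" using runner_core_partition by (simp add: partition_of_def)
  then obtain x where x: "hook_length ?p (i, j) + x = beta ?p i"
      "\<And>k. k < m \<Longrightarrow> beta ?p k \<noteq> x"
    using hook_length_not_beta_diff[OF _ box] len by metis
  have "d dvd s + k * t" using assms by simp
  then obtain c where c: "s + k * t = d * c" ..
  have eq: "d * c + x = 1 + (m - 1 - i) * d"
    using x(1) hook c beta_runner_core[of d i m] assms(1) i by simp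
  \<comment> \<open>A larger \<open>c\<close> would give
    \<open>d * c \<ge> (m - 1 - i) * d + d\<close>, which is too large because
    \<open>d > 1\<close>.\<close>
  have "c \<le> m - 1 - i"
  proof (rule ccontr)
    assume "\<not> c \<le> m - 1 - i"
    then have "d * (m - 1 - i) + d \<le> d * c"
      by (metis Suc_leI mult_Suc_right mult_le_mono2 not_le add.commute)
    then show False using eq assms(1) by (simp add: mult.commute)
  qed
  \<comment> \<open>Now \<open>x\<close> turns out to be the \<open>beta\<close> of the row
    \<open>c\<close> places further down.\<close>
  then obtain e where e: "m - 1 - i = c + e" using le_Suc_ex[OF \<open>c \<le> m - 1 - i\<close>] by blast
  then have "i + c < m" "m - 1 - (i + c) = e" using i by linarith+
  moreover have "x = 1 + e * d" using eq unfolding e by (simp add: algebra_simps)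
  ultimately have "x = 1 + (m - 1 - (i + c)) * d" "i + c < m" by simp_all
  then show False using x(2)[of "i + c"] beta_runner_core[of d "i + c" m] assms(1) by simp
qed

theorem lemma1p5:
  fixes s t d :: nat
  assumes "s \<ge> 1" and "t \<ge> 1" and "d = gcd s t"
  shows "(d = 1 \<longrightarrow> (\<exists>P :: int poly. mod_core_gf s t = fps_of_poly P)) \<and>
         (d > 1 \<longrightarrow> infinite {n. fps_nth (mod_core_gf s t) n \<noteq> 0})"
proof (intro conjI impI)
  have supp: "{n. fps_nth (mod_core_gf s t) n \<noteq> 0} = {n. \<exists>p. partition_of n p \<and> mod_core s t p}"
    by (simp add: mod_core_gf_def num_mod_cores_neq_0_iff del: neq0_conv)
  show "\<exists>P :: int poly. mod_core_gf s t = fps_of_poly P" if "d = 1"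
  proof (rule fps_of_poly_if_finite)
    have "coprime s t" using assms(3) that unfolding coprime_iff_gcd_eq_1 by metis
    then have "finite (sum_list ` {p. (\<exists>n. partition_of n p) \<and> mod_core s t p})"
      using assms(1,2) by (intro finite_imageI finite_coprime_mod_cores)
    then show "finite {n. fps_nth (mod_core_gf s t) n \<noteq> 0}"
      unfolding supp by (rule rev_finite_subset) (auto simp: partition_of_def)
  qed
  show "infinite {n. fps_nth (mod_core_gf s t) n \<noteq> 0}" if "d > 1"
    unfolding supp infinite_nat_iff_unbounded_le
  proof
    fix m
    \<comment> \<open>The sizes are unbounded, since this core has \<open>m\<close> positive
      parts.\<close>
    have "mod_core s t (runner_core d m)"
      using that assms(3) by (intro mod_core_runner_core) simp_all
    then show "\<exists>n\<ge>m. n \<in> {n. \<exists>p. partition_of n p \<and> mod_core s t p}"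
      using runner_core_partition le_sum_list_runner_core by blast
  qed
qed

end
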